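(* Let $Q$ be a group of exponent $n$, let $m \ge 1$, and for $k=1,\dots,m$ let $P_{k,1}, P_{k,2}$ be subgroups of $Q$ and $\rho_k : P_{k,1} \to P_{k,2}$ an isomorphism. Let $$\mathcal{G} = \langle\, Q, y_1,\dots,y_m \;\|\; y_k p y_k^{-1} = \rho_k(p),\ p \in P_{k,1},\ k=1,\dots,m \,\rangle$$ be the corresponding HNN-extension of $Q$ with stable letters $y_1,\dots,y_m$. Suppose that $Q$ naturally embeds in the quotient $\mathcal{G}/\mathcal{G}^n$, i.e. the composition $Q \to \mathcal{G} \to \mathcal{G}/\mathcal{G}^n$ is injective. Then for every $A \in \mathcal{G}$ the subgroup $\langle \tau_A, \mathcal{F}(A)\rangle$ of $\mathrm{Hol}\,\mathcal{F}(A)$ has exponent $n$.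
   Context: A group has exponent $n$ if all of its elements satisfy the identity $x^n = 1$ (the exponent need not be the least such $n$). $\mathcal{G}^n$ is the subgroup of $\mathcal{G}$ generated by all $n$-th powers of elements of $\mathcal{G}$. $Q$ is regarded as a subgroup of the HNN-extension $\mathcal{G}$ in the standard way. For $A \in \mathcal{G}$, $\mathcal{F}(A)$ denotes the (unique) maximal subgroup of $Q$ that is normalized by $A$, i.e. the largest subgroup $F \le Q$ with $A F A^{-1} = F$; $\tau_A$ denotes the automorphism of $\mathcal{F}(A)$ induced by conjugation by $A$, $\tau_A(f) = A f A^{-1}$. $\mathrm{Hol}\,\mathcal{F}(A)$ is the holomorph of $\mathcal{F}(A)$, that is, the semidirect product $\mathcal{F}(A) \rtimes \mathrm{Aut}\,\mathcal{F}(A)$ (in which $\tau f \tau^{-1} = \tau(f)$ for $f\in\mathcal{F}(A)$, $\tau \in \mathrm{Aut}\,\mathcal{F}(A)$), and $\langle \tau_A, \mathcal{F}(A)\rangle$ is its subgroup generated by $\tau_A$ and $\mathcal{F}(A)$. *)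

theory Defs
  imports "HOL-Algebra.Generated_Groups" "HOL-Algebra.Bij"
begin

definition has_exponent :: "('a, 'b) monoid_scheme \<Rightarrow> nat \<Rightarrow> bool" where
  "has_exponent G n \<longleftrightarrow> (\<forall>x\<in>carrier G. x [^]\<^bsub>G\<^esub> n = \<one>\<^bsub>G\<^esub>)"

definition power_subgroup :: "('a, 'b) monoid_scheme \<Rightarrow> nat \<Rightarrow> 'a set" where
  "power_subgroup G n = generate G {x [^]\<^bsub>G\<^esub> n |x. x \<in> carrier G}"


section \<open>HNN-extensions\<close>

text \<open>
  The HNN-extension is the group given by its presentation: words over the elements of \<open>Q\<close> and
  the letters \<open>y\<^sub>k\<close>, \<open>y\<^sub>k\<close>-inverse for \<open>k = 1, \<dots>, m\<close>, modulo the congruence generated by the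
  multiplication table of \<open>Q\<close>, free cancellation, and \<open>y\<^sub>k p y\<^sub>k\<close>-inverse \<open>= \<rho>\<^sub>k(p)\<close>.
\<close>

datatype 'a hnn_letter = Base 'a | Stable nat | StableInv nat

definition hnn_words :: "('a, 'b) monoid_scheme \<Rightarrow> nat \<Rightarrow> 'a hnn_letter list set" where
  "hnn_words Q m = lists (Base ` carrier Q \<union> Stable ` {1..m} \<union> StableInv ` {1..m})"

inductive_set hnn_rel ::
  "('a, 'b) monoid_scheme \<Rightarrow> nat \<Rightarrow> (nat \<Rightarrow> 'a set) \<Rightarrow> (nat \<Rightarrow> 'a \<Rightarrow> 'a)
    \<Rightarrow> ('a hnn_letter list \<times> 'a hnn_letter list) set"
  for Q :: "('a, 'b) monoid_scheme" and m :: nat and P :: "nat \<Rightarrow> 'a set"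
    and \<rho> :: "nat \<Rightarrow> 'a \<Rightarrow> 'a"
where
  refl: "w \<in> hnn_words Q m \<Longrightarrow> (w, w) \<in> hnn_rel Q m P \<rho>"
| sym: "(u, v) \<in> hnn_rel Q m P \<rho> \<Longrightarrow> (v, u) \<in> hnn_rel Q m P \<rho>"
| trans: "(u, v) \<in> hnn_rel Q m P \<rho> \<Longrightarrow> (v, w) \<in> hnn_rel Q m P \<rho> \<Longrightarrow> (u, w) \<in> hnn_rel Q m P \<rho>"
| append: "(u, v) \<in> hnn_rel Q m P \<rho> \<Longrightarrow> (u', v') \<in> hnn_rel Q m P \<rho>
    \<Longrightarrow> (u @ u', v @ v') \<in> hnn_rel Q m P \<rho>"
| base_mult: "a \<in> carrier Q \<Longrightarrow> b \<in> carrier Q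
    \<Longrightarrow> ([Base a, Base b], [Base (a \<otimes>\<^bsub>Q\<^esub> b)]) \<in> hnn_rel Q m P \<rho>"
| base_one: "([Base \<one>\<^bsub>Q\<^esub>], []) \<in> hnn_rel Q m P \<rho>"
| stable_right_inv: "k \<in> {1..m} \<Longrightarrow> ([Stable k, StableInv k], []) \<in> hnn_rel Q m P \<rho>"
| stable_left_inv: "k \<in> {1..m} \<Longrightarrow> ([StableInv k, Stable k], []) \<in> hnn_rel Q m P \<rho>"
| stable_conj: "k \<in> {1..m} \<Longrightarrow> p \<in> P k
    \<Longrightarrow> ([Stable k, Base p, StableInv k], [Base (\<rho> k p)]) \<in> hnn_rel Q m P \<rho>"

definition hnn_extension ::
  "('a, 'b) monoid_scheme \<Rightarrow> nat \<Rightarrow> (nat \<Rightarrow> 'a set) \<Rightarrow> (nat \<Rightarrow> 'a \<Rightarrow> 'a)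
    \<Rightarrow> 'a hnn_letter list set monoid" where
  "hnn_extension Q m P \<rho> =
    \<lparr>carrier = hnn_words Q m // hnn_rel Q m P \<rho>,
     monoid.mult = (\<lambda>U V. \<Union>u\<in>U. \<Union>v\<in>V. hnn_rel Q m P \<rho> `` {u @ v}),
     one = hnn_rel Q m P \<rho> `` {[]}\<rparr>"

definition hnn_incl ::
  "('a, 'b) monoid_scheme \<Rightarrow> nat \<Rightarrow> (nat \<Rightarrow> 'a set) \<Rightarrow> (nat \<Rightarrow> 'a \<Rightarrow> 'a)
    \<Rightarrow> 'a \<Rightarrow> 'a hnn_letter list set" where
  "hnn_incl Q m P \<rho> q = hnn_rel Q m P \<rho> `` {[Base q]}"

locale hnn_data = group Q for Q :: "('a, 'b) monoid_scheme" (structure) +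
  fixes m :: nat
    and P1 P2 :: "nat \<Rightarrow> 'a set"
    and \<rho> :: "nat \<Rightarrow> 'a \<Rightarrow> 'a"
  assumes m_pos: "1 \<le> m"
    and subgroup_P1: "\<And>k. k \<in> {1..m} \<Longrightarrow> subgroup (P1 k) Q"
    and subgroup_P2: "\<And>k. k \<in> {1..m} \<Longrightarrow> subgroup (P2 k) Q"
    and iso_\<rho>: "\<And>k. k \<in> {1..m} \<Longrightarrow> \<rho> k \<in> iso (Q\<lparr>carrier := P1 k\<rparr>) (Q\<lparr>carrier := P2 k\<rparr>)"
begin

abbreviation "R \<equiv> hnn_rel Q m P1 \<rho>"
abbreviation "E \<equiv> hnn_extension Q m P1 \<rho>"

lemma rel_words: "(u, v) \<in> R \<Longrightarrow> u \<in> hnn_words Q m \<and> v \<in> hnn_words Q m"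
proof (induction rule: hnn_rel.induct)
  case (stable_conj k p)
  then have "p \<in> carrier Q" "\<rho> k p \<in> carrier Q"
    using iso_\<rho>[of k] subgroup_P1[of k] subgroup_P2[of k]
    by (auto simp: iso_def hom_def dest: subgroup.mem_carrier)
  then show ?case using stable_conj by (auto simp: hnn_words_def)
qed (auto simp: hnn_words_def)

lemma equiv_rel: "equiv (hnn_words Q m) R"
proof (rule equivI)
  show "R \<subseteq> hnn_words Q m \<times> hnn_words Q m" by (auto dest: rel_words)
  show "refl_on (hnn_words Q m) R" by (rule refl_onI) (rule hnn_rel.refl)
  show "sym R" by (rule symI) (rule hnn_rel.sym)
  show "trans R" by (rule transI) (rule hnn_rel.trans)
qed

lemma append_words: "u \<in> hnn_words Q m \<Longrightarrow> v \<in> hnn_words Q m \<Longrightarrow> u @ v \<in> hnn_words Q m"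
  by (auto simp: hnn_words_def)

lemma mult_class:
  assumes "u \<in> hnn_words Q m" "v \<in> hnn_words Q m"
  shows "(R `` {u}) \<otimes>\<^bsub>E\<^esub> (R `` {v}) = R `` {u @ v}"
proof -
  have eq: "R `` {u' @ v'} = R `` {u @ v}" if "u' \<in> R `` {u}" "v' \<in> R `` {v}" for u' v'
  proof -
    have "(u, u') \<in> R" "(v, v') \<in> R" using that by simp_all
    from equiv_class_eq[OF equiv_rel hnn_rel.append[OF this]] show ?thesis by (rule HOL.sym)
  qed
  have ne: "R `` {u} \<noteq> {}" "R `` {v} \<noteq> {}"
    using hnn_rel.refl[OF assms(1)] hnn_rel.refl[OF assms(2)] by blast+
  have "(\<Union>u'\<in>R `` {u}. \<Union>v'\<in>R `` {v}. R `` {u' @ v'})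
      = (\<Union>u'\<in>R `` {u}. \<Union>v'\<in>R `` {v}. R `` {u @ v})"
    using eq by (intro SUP_cong) simp_all
  also have "\<dots> = R `` {u @ v}" using ne by simp
  finally show ?thesis by (simp add: hnn_extension_def)
qed

lemma carrier_class: "u \<in> hnn_words Q m \<Longrightarrow> R `` {u} \<in> carrier E"
  by (simp add: hnn_extension_def quotientI)

lemma carrierE:
  assumes "Z \<in> carrier E"
  obtains u where "u \<in> hnn_words Q m" "Z = R `` {u}"
  using assms by (auto simp: hnn_extension_def quotient_def)

lemma one_class: "\<one>\<^bsub>E\<^esub> = R `` {[]}"
  by (simp add: hnn_extension_def)

lemma left_inverse_word:
  "u \<in> hnn_words Q m \<Longrightarrow> \<exists>v \<in> hnn_words Q m. (v @ u, []) \<in> R"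
proof (induction u)
  case Nil
  then show ?case by (intro bexI[of _ "[]"]) (simp_all add: hnn_words_def hnn_rel.refl)
next
  case (Cons a u)
  then obtain v where v: "v \<in> hnn_words Q m" "(v @ u, []) \<in> R"
    by (auto simp: hnn_words_def)
  have u: "u \<in> hnn_words Q m" using Cons.prems by (auto simp: hnn_words_def)
  have "\<exists>b. [b] \<in> hnn_words Q m \<and> ([b, a], []) \<in> R"
  proof (cases a)
    case (Base q)
    then have q: "q \<in> carrier Q" using Cons.prems by (auto simp: hnn_words_def)
    have "([Base (inv q), Base q], [Base (inv q \<otimes> q)]) \<in> R"
      using q by (intro hnn_rel.base_mult) auto
    moreover have "([Base (inv q \<otimes> q)], []) \<in> R"
      using q by (simp add: hnn_rel.base_one)
    ultimately show ?thesis
      using Base q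
      by (intro exI[of _ "Base (inv q)"]) (auto simp: hnn_words_def intro: hnn_rel.trans)
  next
    case (Stable k)
    then show ?thesis using Cons.prems
      by (intro exI[of _ "StableInv k"]) (auto simp: hnn_words_def intro: hnn_rel.stable_left_inv)
  next
    case (StableInv k)
    then show ?thesis using Cons.prems
      by (intro exI[of _ "Stable k"]) (auto simp: hnn_words_def intro: hnn_rel.stable_right_inv)
  qed
  then obtain b where b: "[b] \<in> hnn_words Q m" "([b, a], []) \<in> R" by blast
  have "((v @ [b, a]) @ u, (v @ []) @ u) \<in> R"
    using b v(1) u by (intro hnn_rel.append hnn_rel.refl)
  then have "((v @ [b]) @ a # u, []) \<in> R"
    using hnn_rel.trans[OF _ v(2)] by simp
  then show ?case using append_words[OF v(1) b(1)] by blast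
qed

lemma group_hnn_extension: "group E"
proof (rule groupI)
  fix Z assume "Z \<in> carrier E"
  then obtain u where u: "u \<in> hnn_words Q m" "Z = R `` {u}" by (rule carrierE)
  obtain v where v: "v \<in> hnn_words Q m" "(v @ u, []) \<in> R" using left_inverse_word[OF u(1)] by blast
  have "R `` {v} \<otimes>\<^bsub>E\<^esub> Z = \<one>\<^bsub>E\<^esub>"
    using u v by (simp add: mult_class one_class equiv_class_eq[OF equiv_rel])
  then show "\<exists>Y\<in>carrier E. Y \<otimes>\<^bsub>E\<^esub> Z = \<one>\<^bsub>E\<^esub>" using carrier_class[OF v(1)] by blast
next
  have nil: "[] \<in> hnn_words Q m" by (simp add: hnn_words_def)
  show "\<one>\<^bsub>E\<^esub> \<in> carrier E" using nil by (simp add: one_class carrier_class)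
  show "\<one>\<^bsub>E\<^esub> \<otimes>\<^bsub>E\<^esub> Z = Z" if "Z \<in> carrier E" for Z
    using that nil by (elim carrierE) (simp add: one_class mult_class)
next
  fix U V assume "U \<in> carrier E" "V \<in> carrier E"
  then obtain u v where "u \<in> hnn_words Q m" "v \<in> hnn_words Q m" "U = R `` {u}" "V = R `` {v}"
    by (metis carrierE)
  then show "U \<otimes>\<^bsub>E\<^esub> V \<in> carrier E"
    by (simp add: mult_class append_words carrier_class)
next
  fix U V W assume "U \<in> carrier E" "V \<in> carrier E" "W \<in> carrier E"
  then obtain u v w where "u \<in> hnn_words Q m" "v \<in> hnn_words Q m" "w \<in> hnn_words Q m"
    "U = R `` {u}" "V = R `` {v}" "W = R `` {w}"
    by (metis carrierE)
  then show "U \<otimes>\<^bsub>E\<^esub> V \<otimes>\<^bsub>E\<^esub> W = U \<otimes>\<^bsub>E\<^esub> (V \<otimes>\<^bsub>E\<^esub> W)"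
    by (simp add: mult_class append_words)
qed

lemma hom_hnn_incl: "hnn_incl Q m P1 \<rho> \<in> hom Q E"
proof (rule homI)
  fix x y assume xy: "x \<in> carrier Q" "y \<in> carrier Q"
  then have "R `` {[Base x, Base y]} = R `` {[Base (x \<otimes> y)]}"
    by (rule equiv_class_eq[OF equiv_rel hnn_rel.base_mult])
  then show "hnn_incl Q m P1 \<rho> (x \<otimes> y) = hnn_incl Q m P1 \<rho> x \<otimes>\<^bsub>E\<^esub> hnn_incl Q m P1 \<rho> y"
    using xy by (simp add: hnn_incl_def mult_class hnn_words_def)
qed (simp add: hnn_incl_def carrier_class hnn_words_def)

end


section \<open>The largest subgroup normalized by an element\<close>

definition max_normalized_subgroup :: "('a, 'b) monoid_scheme \<Rightarrow> 'a set \<Rightarrow> 'a \<Rightarrow> 'a set" where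
  "max_normalized_subgroup G H A =
    (GREATEST F. subgroup F G \<and> F \<subseteq> H \<and> A <#\<^bsub>G\<^esub> F #>\<^bsub>G\<^esub> inv\<^bsub>G\<^esub> A = F)"

lemma (in group) conj_set_eq_iff:
  assumes "A \<in> carrier G" "F \<subseteq> carrier G"
  shows "A <# F #> inv A = F \<longleftrightarrow> (\<forall>x\<in>F. A \<otimes> x \<otimes> inv A \<in> F \<and> inv A \<otimes> x \<otimes> A \<in> F)"
proof -
  have *: "A <# F #> inv A = (\<lambda>x. A \<otimes> x \<otimes> inv A) ` F"
    by (auto simp: l_coset_def r_coset_def)
  have c1: "inv A \<otimes> (A \<otimes> x \<otimes> inv A) \<otimes> A = x" if "x \<in> carrier G" for x
    using that assms(1) by (simp add: m_assoc) (simp add: m_assoc[symmetric])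
  have c2: "A \<otimes> (inv A \<otimes> x \<otimes> A) \<otimes> inv A = x" if "x \<in> carrier G" for x
    using that assms(1) by (simp add: m_assoc) (simp add: m_assoc[symmetric])
  show ?thesis
  proof
    assume F: "A <# F #> inv A = F"
    show "\<forall>x\<in>F. A \<otimes> x \<otimes> inv A \<in> F \<and> inv A \<otimes> x \<otimes> A \<in> F"
    proof
      fix x assume x: "x \<in> F"
      then obtain y where "y \<in> F" "x = A \<otimes> y \<otimes> inv A" using F * by blast
      then show "A \<otimes> x \<otimes> inv A \<in> F \<and> inv A \<otimes> x \<otimes> A \<in> F"
        using x F * c1 assms(2) by auto
    qed
  next
    assume F: "\<forall>x\<in>F. A \<otimes> x \<otimes> inv A \<in> F \<and> inv A \<otimes> x \<otimes> A \<in> F"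
    have "x \<in> (\<lambda>x. A \<otimes> x \<otimes> inv A) ` F" if "x \<in> F" for x
      using c2[of x] F that assms(2) by (intro image_eqI[of _ _ "inv A \<otimes> x \<otimes> A"]) auto
    then show "A <# F #> inv A = F" using F by (auto simp: *)
  qed
qed

lemma (in group) max_normalized_subgroup:
  assumes "subgroup H G" "A \<in> carrier G"
  defines "F \<equiv> max_normalized_subgroup G H A"
  shows "subgroup F G" "F \<subseteq> H" "A <# F #> inv A = F"
    and "\<And>K. subgroup K G \<Longrightarrow> K \<subseteq> H \<Longrightarrow> A <# K #> inv A = K \<Longrightarrow> K \<subseteq> F"
proof -
  define S where "S = {K. subgroup K G \<and> K \<subseteq> H \<and> A <# K #> inv A = K}"
  define M where "M = generate G (\<Union>S)"
  have SG: "\<Union>S \<subseteq> carrier G" by (auto simp: S_def dest: subgroup.subset)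
  have Mc: "M \<subseteq> carrier G" unfolding M_def by (rule generate_incl[OF SG])
  have sub: "subgroup M G" unfolding M_def by (rule generate_is_subgroup[OF SG])
  have MH: "M \<subseteq> H" unfolding M_def using assms(1)
    by (intro generate_subgroup_incl) (auto simp: S_def)
  have conj: "B \<otimes> x \<otimes> inv B \<in> M"
    if B: "B \<in> carrier G" "\<And>y. y \<in> \<Union>S \<Longrightarrow> B \<otimes> y \<otimes> inv B \<in> \<Union>S" and "x \<in> M" for B x
    using that(3) unfolding M_def
  proof (induction rule: generate.induct)
    case one
    then show ?case using B by (simp add: generate.one)
  next
    case (incl h)
    then show ?case by (intro generate.incl B(2))
  next
    case (inv h)
    then have h: "h \<in> carrier G" using SG by blast
    have "inv (B \<otimes> h \<otimes> inv B) = B \<otimes> inv h \<otimes> inv B"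
      using B(1) h by (simp add: inv_mult_group m_assoc)
    then show ?case using B(2)[OF inv] generate.inv by metis
  next
    case (eng h1 h2)
    have h: "h1 \<in> carrier G" "h2 \<in> carrier G"
      using eng.hyps generate_in_carrier[OF SG] by auto
    have "B \<otimes> (h1 \<otimes> h2) \<otimes> inv B = (B \<otimes> h1 \<otimes> inv B) \<otimes> (B \<otimes> h2 \<otimes> inv B)"
      using B(1) h by (simp add: m_assoc) (simp add: m_assoc[symmetric])
    then show ?case using eng.IH by (simp add: generate.eng)
  qed
  have S1: "A \<otimes> y \<otimes> inv A \<in> \<Union>S \<and> inv A \<otimes> y \<otimes> A \<in> \<Union>S" if "y \<in> \<Union>S" for y
  proof -
    from that obtain K where K: "K \<in> S" "y \<in> K" by blast
    then have "A \<otimes> y \<otimes> inv A \<in> K \<and> inv A \<otimes> y \<otimes> A \<in> K"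
      using conj_set_eq_iff[of A K] assms(2) by (auto simp: S_def dest: subgroup.subset)
    then show ?thesis using K(1) by blast
  qed
  have norm: "A <# M #> inv A = M"
    unfolding conj_set_eq_iff[OF assms(2) Mc]
    using conj[of A] conj[of "inv A"] S1 assms(2) by simp
  have top: "K \<subseteq> M" if "K \<in> S" for K
    using that generate.incl[of _ "\<Union>S" G] by (auto simp: M_def)
  have "F = M" unfolding F_def max_normalized_subgroup_def
    using sub MH norm top by (intro Greatest_equality) (auto simp: S_def)
  then show "subgroup F G" "F \<subseteq> H" "A <# F #> inv A = F"
    "\<And>K. subgroup K G \<Longrightarrow> K \<subseteq> H \<Longrightarrow> A <# K #> inv A = K \<Longrightarrow> K \<subseteq> F"
    using sub MH norm top by (auto simp: S_def)
qed


section \<open>The holomorph\<close>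

text \<open>\<open>(f, \<sigma>)\<close> stands for the product \<open>f \<sigma>\<close>, so that \<open>\<sigma> f \<sigma>\<close>-inverse \<open>= \<sigma>(f)\<close>.\<close>

definition holomorph :: "('a, 'b) monoid_scheme \<Rightarrow> ('a \<times> ('a \<Rightarrow> 'a)) monoid" where
  "holomorph F =
    \<lparr>carrier = carrier F \<times> auto F,
     monoid.mult = (\<lambda>(f, \<sigma>) (g, \<tau>). (f \<otimes>\<^bsub>F\<^esub> \<sigma> g, \<sigma> \<otimes>\<^bsub>AutoGroup F\<^esub> \<tau>)),
     one = (\<one>\<^bsub>F\<^esub>, \<one>\<^bsub>AutoGroup F\<^esub>)\<rparr>"

definition hol_base :: "('a, 'b) monoid_scheme \<Rightarrow> 'a \<Rightarrow> 'a \<times> ('a \<Rightarrow> 'a)" where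
  "hol_base F f = (f, \<one>\<^bsub>AutoGroup F\<^esub>)"

definition hol_auto :: "('a, 'b) monoid_scheme \<Rightarrow> ('a \<Rightarrow> 'a) \<Rightarrow> 'a \<times> ('a \<Rightarrow> 'a)" where
  "hol_auto F \<sigma> = (\<one>\<^bsub>F\<^esub>, \<sigma>)"

text \<open>Automorphisms in \<^const>\<open>auto\<close> are extensional, hence the restriction.\<close>

definition conj_auto :: "('a, 'b) monoid_scheme \<Rightarrow> 'a set \<Rightarrow> 'a \<Rightarrow> 'a \<Rightarrow> 'a" where
  "conj_auto G F A = (\<lambda>f\<in>F. A \<otimes>\<^bsub>G\<^esub> f \<otimes>\<^bsub>G\<^esub> inv\<^bsub>G\<^esub> A)"

lemma (in group) conj_auto_in_auto:
  assumes "subgroup F G" "A \<in> carrier G" "A <# F #> inv A = F"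
  shows "conj_auto G F A \<in> auto (G\<lparr>carrier := F\<rparr>)"
proof -
  have Fc: "x \<in> carrier G" if "x \<in> F" for x using subgroup.mem_carrier[OF assms(1) that] .
  have im: "(\<lambda>f. A \<otimes> f \<otimes> inv A) ` F = F"
    using assms(3) by (auto simp: l_coset_def r_coset_def)
  have inj: "inj_on (\<lambda>f. A \<otimes> f \<otimes> inv A) F"
    using Fc assms(2) by (intro inj_onI) simp
  have "A \<otimes> (x \<otimes> y) \<otimes> inv A = (A \<otimes> x \<otimes> inv A) \<otimes> (A \<otimes> y \<otimes> inv A)" if "x \<in> F" "y \<in> F" for x y
    using Fc[OF that(1)] Fc[OF that(2)] assms(2)
    by (simp add: m_assoc) (simp add: m_assoc[symmetric])
  then show ?thesis using im inj subgroup.m_closed[OF assms(1)]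
    by (auto simp: conj_auto_def auto_def hom_def Bij_def bij_betw_def inj_on_def)
qed

lemma (in group) group_holomorph: "group (holomorph G)"
proof -
  interpret A: group "AutoGroup G" by (rule AutoGroup)
  have cA: "carrier (AutoGroup G) = auto G" by (simp add: AutoGroup_def)
  have mA: "(\<sigma> \<otimes>\<^bsub>AutoGroup G\<^esub> \<tau>) x = \<sigma> (\<tau> x)"
    if "\<sigma> \<in> auto G" "\<tau> \<in> auto G" "x \<in> carrier G" for \<sigma> \<tau> x
    using that by (simp add: AutoGroup_def BijGroup_def auto_def compose_def)
  have oA: "\<one>\<^bsub>AutoGroup G\<^esub> x = x" if "x \<in> carrier G" for x
    using that by (simp add: AutoGroup_def BijGroup_def)
  have clo: "\<sigma> x \<in> carrier G" if "\<sigma> \<in> auto G" "x \<in> carrier G" for \<sigma> x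
    using that by (auto simp: auto_def hom_def)
  have hm: "\<sigma> (x \<otimes> y) = \<sigma> x \<otimes> \<sigma> y" if "\<sigma> \<in> auto G" "x \<in> carrier G" "y \<in> carrier G" for \<sigma> x y
    using that by (auto simp: auto_def hom_def)
  note A = A.m_closed[unfolded cA] A.m_assoc[unfolded cA] A.one_closed[unfolded cA]
    A.l_one[unfolded cA] A.l_inv[unfolded cA] A.inv_closed[unfolded cA]
  show ?thesis
  proof (rule groupI)
    fix x assume "x \<in> carrier (holomorph G)"
    then obtain f \<sigma> where x: "x = (f, \<sigma>)" "f \<in> carrier G" "\<sigma> \<in> auto G" by (auto simp: holomorph_def)
    define \<tau> where "\<tau> = inv\<^bsub>AutoGroup G\<^esub> \<sigma>"
    have \<tau>: "\<tau> \<in> auto G" "\<tau> \<otimes>\<^bsub>AutoGroup G\<^esub> \<sigma> = \<one>\<^bsub>AutoGroup G\<^esub>" using x A by (auto simp: \<tau>_def)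
    show "\<exists>y\<in>carrier (holomorph G). y \<otimes>\<^bsub>holomorph G\<^esub> x = \<one>\<^bsub>holomorph G\<^esub>"
      using x \<tau> clo[OF \<tau>(1) x(2)]
      by (intro bexI[of _ "(inv (\<tau> f), \<tau>)"]) (auto simp: holomorph_def)
  qed (auto simp: holomorph_def A mA oA clo hm m_assoc)
qed

end

(*
  Every element of the subgroup has the form (f, conj B) with B normalizing F, and its n-th power
  is (c, conj (B^n)), where c = (f B)^n (B^n)^-1. Here c and all commutators of B^n with elements
  of F lie both in F and in the subgroup generated by n-th powers, and these meet trivially as Q
  embeds in the quotient.
*)
theory Submission
  imports Defs
begin

context group
begin

section \<open>Elements normalizing a subgroup\<close>

definition normalizes :: "'a \<Rightarrow> 'a set \<Rightarrow> bool" where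
  "normalizes B F \<longleftrightarrow> B \<in> carrier G \<and> B <# F #> inv B = F"

text \<open>Equality of a set with its conjugate becomes an elementwise condition. Both directions
  are required: for infinite \<open>F\<close>, conjugation by \<open>B\<close> may map
  \<open>F\<close> onto a proper subset of itself.\<close>

lemma normalizes_iff:
  assumes "F \<subseteq> carrier G"
  shows "normalizes B F \<longleftrightarrow>
    B \<in> carrier G \<and> (\<forall>x\<in>F. B \<otimes> x \<otimes> inv B \<in> F \<and> inv B \<otimes> x \<otimes> B \<in> F)"
  using conj_set_eq_iff[OF _ assms] by (auto simp: normalizes_def)

lemma normalizes_conj:
  assumes "subgroup F G" "normalizes B F" "x \<in> F"
  shows "B \<otimes> x \<otimes> inv B \<in> F"
  using assms(2,3) by (simp add: normalizes_iff[OF subgroup.subset[OF assms(1)]])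

lemma normalizes_one: "F \<subseteq> carrier G \<Longrightarrow> normalizes \<one> F"
  by (auto simp: normalizes_iff)

lemma normalizes_inv: "F \<subseteq> carrier G \<Longrightarrow> normalizes B F \<Longrightarrow> normalizes (inv B) F"
  by (simp add: normalizes_iff)

lemma conj_mult:
  assumes "B \<in> carrier G" "C \<in> carrier G" "x \<in> carrier G"
  shows "(B \<otimes> C) \<otimes> x \<otimes> inv (B \<otimes> C) = B \<otimes> (C \<otimes> x \<otimes> inv C) \<otimes> inv B"
  using assms by (simp add: m_assoc inv_mult_group)

lemma normalizes_mult:
  assumes F: "F \<subseteq> carrier G" and B: "normalizes B F" and C: "normalizes C F"
  shows "normalizes (B \<otimes> C) F"
proof -
  have c: "B \<in> carrier G" "C \<in> carrier G" using B C by (auto simp: normalizes_def)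
  have "inv (B \<otimes> C) \<otimes> x \<otimes> (B \<otimes> C) = inv C \<otimes> (inv B \<otimes> x \<otimes> B) \<otimes> C" if "x \<in> F" for x
    using c that F by (simp add: m_assoc inv_mult_group subsetD)
  moreover have "(B \<otimes> C) \<otimes> x \<otimes> inv (B \<otimes> C) = B \<otimes> (C \<otimes> x \<otimes> inv C) \<otimes> inv B" if "x \<in> F" for x
    using c that F by (intro conj_mult) auto
  ultimately show ?thesis using B C c by (simp add: normalizes_iff[OF F])
qed

lemma normalizes_pow:
  fixes j :: nat
  assumes "F \<subseteq> carrier G" "normalizes B F"
  shows "normalizes (B [^] j) F"
  using assms by (induction j) (simp_all add: normalizes_one normalizes_mult)

section \<open>Conjugation automorphisms and their pairs in the holomorph\<close>

lemma conj_auto_closed: "normalizes B F \<Longrightarrow> subgroup F G \<Longrightarrow> conj_auto G F B \<in> auto (G\<lparr>carrier := F\<rparr>)"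
  by (simp add: normalizes_def conj_auto_in_auto)

text \<open>Both sides are the identity on \<open>F\<close> and \<open>undefined\<close> outside it,
  so they agree as functions.\<close>

lemma conj_auto_one:
  assumes "F \<subseteq> carrier G"
  shows "conj_auto G F \<one> = \<one>\<^bsub>AutoGroup (G\<lparr>carrier := F\<rparr>)\<^esub>"
  using assms by (auto simp: conj_auto_def AutoGroup_def BijGroup_def restrict_def fun_eq_iff)

lemma conj_auto_mult:
  assumes F: "subgroup F G" and B: "normalizes B F" and C: "normalizes C F"
  shows "conj_auto G F B \<otimes>\<^bsub>AutoGroup (G\<lparr>carrier := F\<rparr>)\<^esub> conj_auto G F C = conj_auto G F (B \<otimes> C)"
proof -
  have Fc: "F \<subseteq> carrier G" using F by (rule subgroup.subset)
  \<comment> \<open>Multiplication in \<open>BijGroup\<close> is composition restricted to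
    bijections, so membership must be known before the product unfolds to
    \<open>compose\<close>.\<close>
  have "conj_auto G F B \<in> Bij F" "conj_auto G F C \<in> Bij F"
    using conj_auto_closed[OF B F] conj_auto_closed[OF C F] by (simp_all add: auto_def)
  then have "conj_auto G F B \<otimes>\<^bsub>AutoGroup (G\<lparr>carrier := F\<rparr>)\<^esub> conj_auto G F C
      = compose F (conj_auto G F B) (conj_auto G F C)"
    by (simp add: AutoGroup_def BijGroup_def)
  also have "\<dots> = conj_auto G F (B \<otimes> C)"
  proof
    fix x
    show "compose F (conj_auto G F B) (conj_auto G F C) x = conj_auto G F (B \<otimes> C) x"
      using B C Fc conj_mult[of B C x] by (auto simp: compose_def conj_auto_def normalizes_iff[OF Fc])
  qed
  finally show ?thesis .
qed

text \<open>The pair \<open>(f, conj_auto G F B)\<close> mirrors the product f B in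
  \<open>G\<close>, and the formula is f B g C = f (B g B^-1) (B C).\<close>

lemma hol_conj_mult:
  assumes "subgroup F G" "normalizes B F" "normalizes C F" "g \<in> F"
  shows "(f, conj_auto G F B) \<otimes>\<^bsub>holomorph (G\<lparr>carrier := F\<rparr>)\<^esub> (g, conj_auto G F C)
    = (f \<otimes> (B \<otimes> g \<otimes> inv B), conj_auto G F (B \<otimes> C))"
  using assms conj_auto_mult[OF assms(1-3)] by (simp add: holomorph_def conj_auto_def)

lemma hol_conj_one:
  assumes "subgroup F G"
  shows "\<one>\<^bsub>holomorph (G\<lparr>carrier := F\<rparr>)\<^esub> = (\<one>, conj_auto G F \<one>)"
  using conj_auto_one[OF subgroup.subset[OF assms]] by (simp add: holomorph_def)

lemma group_hol: "subgroup F G \<Longrightarrow> group (holomorph (G\<lparr>carrier := F\<rparr>))"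
  by (intro group.group_holomorph subgroup.subgroup_is_group) (auto intro: group_axioms)

lemma hol_conj_carrier:
  "subgroup F G \<Longrightarrow> normalizes B F \<Longrightarrow> f \<in> F
    \<Longrightarrow> (f, conj_auto G F B) \<in> carrier (holomorph (G\<lparr>carrier := F\<rparr>))"
  by (simp add: holomorph_def conj_auto_closed)

text \<open>This mirrors (f B)^-1 = (B^-1 f^-1 B) B^-1 in \<open>G\<close>.\<close>

lemma hol_conj_inv:
  assumes F: "subgroup F G" and B: "normalizes B F" and f: "f \<in> F"
  shows "inv\<^bsub>holomorph (G\<lparr>carrier := F\<rparr>)\<^esub> (f, conj_auto G F B)
    = (inv B \<otimes> inv f \<otimes> B, conj_auto G F (inv B))"
proof -
  interpret H: group "holomorph (G\<lparr>carrier := F\<rparr>)" using F by (rule group_hol)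
  have Fc: "F \<subseteq> carrier G" using F by (rule subgroup.subset)
  have c: "B \<in> carrier G" "f \<in> carrier G" "normalizes (inv B) F"
    using B f Fc by (auto simp: normalizes_def[of B] normalizes_inv)
  have cl: "inv B \<otimes> inv f \<otimes> B \<in> F"
    using B subgroup.m_inv_closed[OF F f] by (simp add: normalizes_iff[OF Fc])
  have "inv B \<otimes> inv f \<otimes> B \<otimes> (inv B \<otimes> f \<otimes> B) = \<one>"
  proof -
    have "B \<otimes> (inv B \<otimes> (f \<otimes> B)) = f \<otimes> B" "inv f \<otimes> (f \<otimes> B) = B"
      using c by (simp_all flip: m_assoc)
    then show ?thesis using c by (simp add: m_assoc)
  qed
  then show ?thesis
    using c cl B f by (intro H.inv_equality)
      (simp_all add: hol_conj_mult[OF F] hol_conj_carrier[OF F] hol_conj_one[OF F])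
qed

text \<open>Pairs of this form include the generators and are closed under products and inverses.
  Only existence of \<open>B\<close> is claimed: different elements can induce the same
  automorphism.\<close>

lemma generate_hol_conj:
  assumes F: "subgroup F G" and A: "normalizes A F"
    and x: "x \<in> generate (holomorph (G\<lparr>carrier := F\<rparr>))
      ({hol_auto (G\<lparr>carrier := F\<rparr>) (conj_auto G F A)} \<union> hol_base (G\<lparr>carrier := F\<rparr>) ` F)"
  obtains f B where "f \<in> F" "normalizes B F" "x = (f, conj_auto G F B)"
proof -
  let ?S = "{hol_auto (G\<lparr>carrier := F\<rparr>) (conj_auto G F A)} \<union> hol_base (G\<lparr>carrier := F\<rparr>) ` F"
  have Fc: "F \<subseteq> carrier G" using F by (rule subgroup.subset)
  \<comment> \<open>The automorphism generator is the pair with \<open>f = \<one>\<close> and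
    \<open>B = A\<close>; an element of \<open>F\<close> is paired with
    \<open>B = \<one>\<close>.\<close>
  have gen: "\<exists>f B. f \<in> F \<and> normalizes B F \<and> y = (f, conj_auto G F B)" if "y \<in> ?S" for y
    using that A conj_auto_one[OF Fc] normalizes_one[OF Fc] subgroup.one_closed[OF F]
    by (auto simp: hol_auto_def hol_base_def) metis
  from x have "\<exists>f B. f \<in> F \<and> normalizes B F \<and> x = (f, conj_auto G F B)"
  proof (induction rule: generate.induct)
    case one
    then show ?case
      using hol_conj_one[OF F] normalizes_one[OF Fc] subgroup.one_closed[OF F] by blast
  next
    case (incl h)
    then show ?case by (rule gen)
  next
    case (inv h)
    then obtain f B where h: "f \<in> F" "normalizes B F" "h = (f, conj_auto G F B)"
      using gen by blast
    have "inv B \<otimes> inv f \<otimes> B \<in> F"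
      using h subgroup.m_inv_closed[OF F h(1)] by (simp add: normalizes_iff[OF Fc])
    then show ?case
      using hol_conj_inv[OF F h(2,1)] normalizes_inv[OF Fc h(2)] h(3) by blast
  next
    case (eng h1 h2)
    then obtain f B g C where h: "f \<in> F" "normalizes B F" "h1 = (f, conj_auto G F B)"
      "g \<in> F" "normalizes C F" "h2 = (g, conj_auto G F C)"
      by blast
    have "f \<otimes> (B \<otimes> g \<otimes> inv B) \<in> F"
      by (rule subgroup.m_closed[OF F h(1) normalizes_conj[OF F h(2,4)]])
    then show ?case
      using hol_conj_mult[OF F h(2,5,4)] normalizes_mult[OF Fc h(2,5)] h(3,6) by blast
  qed
  then show thesis using that by blast
qed

text \<open>The equation for \<open>c\<close> makes the first coordinate computable in
  \<open>G\<close>: it is the factor left of B^j when (f B)^j is written as an element of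
  \<open>F\<close> times B^j.\<close>

lemma hol_conj_pow:
  fixes j :: nat
  assumes F: "subgroup F G" and B: "normalizes B F" and f: "f \<in> F"
  shows "\<exists>c\<in>F. (f, conj_auto G F B) [^]\<^bsub>holomorph (G\<lparr>carrier := F\<rparr>)\<^esub> j = (c, conj_auto G F (B [^] j))
    \<and> c \<otimes> B [^] j = (f \<otimes> B) [^] j"
proof (induction j)
  case 0
  then show ?case using subgroup.one_closed[OF F] by (simp add: hol_conj_one[OF F])
next
  case (Suc j)
  then obtain c where c: "c \<in> F"
    "(f, conj_auto G F B) [^]\<^bsub>holomorph (G\<lparr>carrier := F\<rparr>)\<^esub> j = (c, conj_auto G F (B [^] j))"
    "c \<otimes> B [^] j = (f \<otimes> B) [^] j" by blast
  have Fc: "F \<subseteq> carrier G" using F by (rule subgroup.subset)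
  have Bj: "normalizes (B [^] j) F" by (rule normalizes_pow[OF Fc B])
  have G: "B \<in> carrier G" "f \<in> carrier G" "c \<in> carrier G" "B [^] j \<in> carrier G"
    using B f c Fc by (auto simp: normalizes_def)
  have "c \<otimes> (B [^] j \<otimes> f \<otimes> inv (B [^] j)) \<in> F"
    by (rule subgroup.m_closed[OF F c(1) normalizes_conj[OF F Bj f]])
  \<comment> \<open>The new first coordinate is c (B^j f B^-j). Multiplying by B^(j+1) cancels B^-j
    and leaves (c B^j) (f B), the next power of f B.\<close>
  moreover have "c \<otimes> (B [^] j \<otimes> f \<otimes> inv (B [^] j)) \<otimes> (B [^] j \<otimes> B) = (c \<otimes> B [^] j) \<otimes> (f \<otimes> B)"
  proof -
    have "inv (B [^] j) \<otimes> (B [^] j \<otimes> B) = B" using G by (simp flip: m_assoc)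
    then show ?thesis using G by (simp add: m_assoc del: nat_pow_Suc)
  qed
  ultimately show ?case using c(2,3) by (auto simp: hol_conj_mult[OF F Bj B f])
qed

section \<open>The subgroup generated by n-th powers\<close>

lemma power_subgroup_normal: "power_subgroup G n \<lhd> G"
  unfolding power_subgroup_def
proof (rule normal_generateI)
  fix h g assume "h \<in> {x [^] n |x. x \<in> carrier G}" and g: "g \<in> carrier G"
  then obtain x where x: "x \<in> carrier G" "h = x [^] n" by blast
  \<comment> \<open>Conjugation commutes with powers, so a conjugate of an n-th power is again an
    n-th power and the generating set is invariant.\<close>
  have "(g \<otimes> x \<otimes> inv g) [^] j = g \<otimes> x [^] j \<otimes> inv g" for j :: nat
  proof (induction j)
    case (Suc j)
    have "inv g \<otimes> (g \<otimes> (x \<otimes> inv g)) = x \<otimes> inv g" using x g by (simp flip: m_assoc)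
    then show ?case using Suc x g by (simp add: m_assoc)
  qed (use g in simp)
  then show "g \<otimes> h \<otimes> inv g \<in> {x [^] n |x. x \<in> carrier G}"
    using x g by (intro CollectI exI[of _ "g \<otimes> x \<otimes> inv g"]) simp
qed auto

text \<open>The two coordinates of the n-th power are trivial separately, each because some element
  lies in both \<open>F\<close> and \<open>power_subgroup G n\<close>.\<close>

lemma hol_conj_pow_trivial:
  assumes F: "subgroup F G" and triv: "F \<inter> power_subgroup G n \<subseteq> {\<one>}"
    and B: "normalizes B F" and f: "f \<in> F"
  shows "(f, conj_auto G F B) [^]\<^bsub>holomorph (G\<lparr>carrier := F\<rparr>)\<^esub> n = \<one>\<^bsub>holomorph (G\<lparr>carrier := F\<rparr>)\<^esub>"
proof -
  interpret N: normal "power_subgroup G n" G by (rule power_subgroup_normal)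
  have Fc: "F \<subseteq> carrier G" using F by (rule subgroup.subset)
  have pow: "x [^] n \<in> power_subgroup G n" if "x \<in> carrier G" for x
    using that unfolding power_subgroup_def by (intro generate.incl) blast
  obtain c where c: "c \<in> F"
    "(f, conj_auto G F B) [^]\<^bsub>holomorph (G\<lparr>carrier := F\<rparr>)\<^esub> n = (c, conj_auto G F (B [^] n))"
    "c \<otimes> B [^] n = (f \<otimes> B) [^] n" using hol_conj_pow[OF F B f] by blast
  have G: "B \<in> carrier G" "f \<in> carrier G" "c \<in> carrier G" "B [^] n \<in> carrier G"
    using B f c Fc by (auto simp: normalizes_def)
  \<comment> \<open>First coordinate: \<open>c\<close> is a quotient of two n-th powers.\<close>
  have "c = (f \<otimes> B) [^] n \<otimes> inv (B [^] n)" using G by (simp add: c(3)[symmetric] m_assoc)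
  then have "c \<in> power_subgroup G n" using G pow by simp
  then have "c = \<one>" using c(1) triv by blast
  moreover have "B [^] n \<otimes> g \<otimes> inv (B [^] n) = g" if g: "g \<in> F" for g
  proof -
    have gG: "g \<in> carrier G" using g Fc by blast
    \<comment> \<open>Second coordinate: by normality g B^-n g^-1 stays in the power subgroup, hence
      so does the commutator of B^n and \<open>g\<close>.\<close>
    have "g \<otimes> inv (B [^] n) \<otimes> inv g \<in> power_subgroup G n"
      using N.inv_op_closed2[OF gG] pow[OF G(1)] by simp
    then have "B [^] n \<otimes> (g \<otimes> inv (B [^] n) \<otimes> inv g) \<in> power_subgroup G n"
      using pow[OF G(1)] by simp
    then have "B [^] n \<otimes> g \<otimes> inv (B [^] n) \<otimes> inv g \<in> power_subgroup G n"
      using G gG by (simp add: m_assoc)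
    \<comment> \<open>The same commutator is (B^n g B^-n) g^-1, a product of two elements of
      \<open>F\<close>, since B^n normalizes \<open>F\<close>.\<close>
    moreover have "B [^] n \<otimes> g \<otimes> inv (B [^] n) \<otimes> inv g \<in> F"
      by (intro subgroup.m_closed[OF F] subgroup.m_inv_closed[OF F] normalizes_conj[OF F] g
          normalizes_pow[OF Fc B])
    ultimately have "B [^] n \<otimes> g \<otimes> inv (B [^] n) \<otimes> inv g = \<one>" using triv by blast
    then show ?thesis using G gG right_cancel[of "inv g" "B [^] n \<otimes> g \<otimes> inv (B [^] n)" g] by simp
  qed
  then have "conj_auto G F (B [^] n) = conj_auto G F \<one>"
    using Fc by (auto simp: conj_auto_def fun_eq_iff)
  ultimately show ?thesis using c(2) by (simp add: hol_conj_one[OF F])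
qed

end

section \<open>Application to the HNN-extension\<close>

lemma image_inter_trivial:
  assumes "group_hom Q G \<iota>" "subgroup N G" "inj_on (\<lambda>q. N #>\<^bsub>G\<^esub> \<iota> q) (carrier Q)"
  shows "\<iota> ` carrier Q \<inter> N \<subseteq> {\<one>\<^bsub>G\<^esub>}"
proof clarify
  interpret group_hom Q G \<iota> by fact
  fix q assume q: "q \<in> carrier Q" "\<iota> q \<in> N"
  \<comment> \<open>Both cosets equal \<open>N\<close>, so injectivity of the coset map identifies
    \<open>q\<close> with the identity.\<close>
  have "N #>\<^bsub>G\<^esub> \<iota> q = N #>\<^bsub>G\<^esub> \<iota> \<one>\<^bsub>Q\<^esub>"
    using q assms(2) by (simp add: H.coset_join2 subgroup.subset)
  then have "q = \<one>\<^bsub>Q\<^esub>" using inj_onD[OF assms(3)] q(1) by simp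
  then show "\<iota> q = \<one>\<^bsub>G\<^esub>" by simp
qed

theorem mainTheorem2:
  fixes Q :: "('a, 'b) monoid_scheme"
    and n m :: nat
    and P1 P2 :: "nat \<Rightarrow> 'a set"
    and \<rho> :: "nat \<Rightarrow> 'a \<Rightarrow> 'a"
    and A :: "'a hnn_letter list set"
  defines "\<G> \<equiv> hnn_extension Q m P1 \<rho>"
    and "\<iota> \<equiv> hnn_incl Q m P1 \<rho>"
  defines "\<F> \<equiv> max_normalized_subgroup \<G> (\<iota> ` carrier Q) A"
  defines "Hol \<equiv> holomorph (\<G>\<lparr>carrier := \<F>\<rparr>)"
  assumes "group Q"
    and "has_exponent Q n"
    and "m \<ge> 1"
    and "\<And>k. k \<in> {1..m} \<Longrightarrow> subgroup (P1 k) Q"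
    and "\<And>k. k \<in> {1..m} \<Longrightarrow> subgroup (P2 k) Q"
    and "\<And>k. k \<in> {1..m} \<Longrightarrow> \<rho> k \<in> iso (Q\<lparr>carrier := P1 k\<rparr>) (Q\<lparr>carrier := P2 k\<rparr>)"
    and "inj_on (\<lambda>q. power_subgroup \<G> n #>\<^bsub>\<G>\<^esub> \<iota> q) (carrier Q)"
    and "A \<in> carrier \<G>"
  shows "has_exponent
    (Hol\<lparr>carrier := generate Hol
       ({hol_auto (\<G>\<lparr>carrier := \<F>\<rparr>) (conj_auto \<G> \<F> A)}
          \<union> hol_base (\<G>\<lparr>carrier := \<F>\<rparr>) ` \<F>)\<rparr>) n"
proof -
  interpret D: hnn_data Q m P1 P2 \<rho>
    using assms(5,7-10) by (intro hnn_data.intro hnn_data_axioms.intro)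
  interpret G: group \<G> unfolding \<G>_def by (rule D.group_hnn_extension)
  interpret \<iota>: group_hom Q \<G> \<iota>
    using D.hom_hnn_incl by unfold_locales (simp add: \<G>_def \<iota>_def)
  have F: "subgroup \<F> \<G>" "\<F> \<subseteq> \<iota> ` carrier Q" "G.normalizes A \<F>"
    unfolding G.normalizes_def \<F>_def using \<iota>.img_is_subgroup assms(12)
    by (auto dest: G.max_normalized_subgroup(1-3))
  \<comment> \<open>The embedding of \<open>Q\<close> in the quotient enters here:
    \<open>\<F>\<close> lies in the image of \<open>Q\<close>, which meets the power subgroup
    trivially.\<close>
  have triv: "\<F> \<inter> power_subgroup \<G> n \<subseteq> {\<one>\<^bsub>\<G>\<^esub>}"
    using F(2) image_inter_trivial[OF \<iota>.group_hom_axioms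
        normal_imp_subgroup[OF G.power_subgroup_normal] assms(11)] by blast
  have "x [^]\<^bsub>Hol\<^esub> n = \<one>\<^bsub>Hol\<^esub>" if "x \<in> generate Hol
       ({hol_auto (\<G>\<lparr>carrier := \<F>\<rparr>) (conj_auto \<G> \<F> A)} \<union> hol_base (\<G>\<lparr>carrier := \<F>\<rparr>) ` \<F>)" for x
    using that unfolding Hol_def
    by (elim G.generate_hol_conj[OF F(1,3)]) (simp add: G.hol_conj_pow_trivial[OF F(1) triv])
  \<comment> \<open>Unfolding \<open>nat_pow_def\<close> identifies powers in the generated subgroup
    with powers in \<open>Hol\<close>, as only the carrier differs.\<close>
  then show ?thesis by (simp add: has_exponent_def nat_pow_def)
qed

end
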